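(* For $g=\begin{pmatrix} a & b \\ c & d \end{pmatrix}\in\mathrm{GL}_2(\mathbb C)$ let $$\hat g=\frac1{\det g}\begin{pmatrix} d^2 & -cd & c^2 \\ -2bd & bc+ad & -2ac \\ b^2 & -ab & a^2 \end{pmatrix}$$ and let $g^\dagger=\begin{pmatrix} d & -b \\ -c & a \end{pmatrix}$ be the adjoint matrix of $g$. The group $\mathrm{GL}_2$ acts on the affine scheme $\Pi_{\mathbb A}^{15}$ by the following rule: for $g\in\mathrm{GL}_2$, $$\begin{pmatrix} p_1 & p_3 \\ p_2 & p_4 \\ u_1 & u_2 \end{pmatrix}\mapsto\begin{pmatrix} p_1 & p_3 \\ p_2 & p_4 \\ u_1 & u_2 \end{pmatrix}g,\qquad\begin{pmatrix} s_1 \\ s_2 \\ s_3 \end{pmatrix}\mapsto\det g\begin{pmatrix} s_1 \\ s_2 \\ s_3 \end{pmatrix},\qquad\begin{pmatrix} t_{123} & t_{125} \\ t_{124} & t_{126} \end{pmatrix}\mapsto g^\dagger\begin{pmatrix} t_{123} & t_{125} \\ t_{124} & t_{126} \end{pmatrix},$$ $$\begin{pmatrix} t_{136} & t_{245} & t_{246} \\ -t_{135} & -t_{136} & -t_{245} \end{pmatrix}\mapsto{}^t\!g\begin{pmatrix} t_{136} & t_{245} & t_{246} \\ -t_{135} & -t_{136} & -t_{245} \end{pmatrix}\hat g,\qquad t_1\mapsto t_1,\quad t_2\mapsto t_2.$$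
   Context: Over $\mathbb C$. The rule is understood as a right action on points (equivalently a left action through $g^{-1}$). **Definition of $\Pi_{\mathbb A}^{15}$.** $\mathbb A_\Pi$ is the affine $19$-space with coordinates $p_1,\dots,p_4,u_1,u_2,s_1,s_2,s_3,t_1,t_2,t_{123},t_{124},t_{125},t_{126},t_{135},t_{136},t_{245},t_{246}$. Abbreviate $D=p_1p_4-p_2p_3$; $U_1=p_1^2+t_1p_2^2+p_2u_1$, $U_2=2p_1p_3+2t_1p_2p_4+p_4u_1+p_2u_2$, $U_3=p_3^2+t_1p_4^2+p_4u_2$; $I_1=t_2p_2^2+p_1u_1$, $I_2=2t_2p_2p_4+p_3u_1+p_1u_2$, $I_3=t_2p_4^2+p_3u_2$; $A_1=t_1p_2u_1-t_2p_1p_2+u_1^2$, $A_2=t_1(p_4u_1+p_2u_2)-t_2(p_2p_3+p_1p_4)+2u_1u_2$, $A_3=t_1p_4u_2-t_2p_3p_4+u_2^2$; $\alpha=t_{136}^2-t_{135}t_{245}$, $\beta=t_{135}t_{246}-t_{136}t_{245}$, $\gamma=t_{245}^2-t_{136}t_{246}$; $a_0=t_{123}t_{136}-t_{124}t_{135}$, $a_1=t_{123}t_{245}-t_{124}t_{136}$, $a_2=t_{123}t_{246}-t_{124}t_{245}$; $b_0=t_{125}t_{136}-t_{126}t_{135}$, $b_1=t_{125}t_{245}-t_{126}t_{136}$, $b_2=t_{125}t_{246}-t_{126}t_{245}$. $\Pi_{\mathbb A}^{15}$ is the closed subscheme defined by $F_1=\dots=F_9=0$, where $F_1=u_1s_1-p_1s_2-p_2s_3-t_{126}D-(t_{136}U_1+t_{245}U_2+t_{246}U_3)$,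 $F_2=u_2s_1-p_3s_2-p_4s_3+t_{125}D+t_{135}U_1+t_{136}U_2+t_{245}U_3$, $F_3=-t_2p_2s_1+(t_1p_2+u_1)s_2-p_1s_3-t_{124}D-(t_{136}I_1+t_{245}I_2+t_{246}I_3)$, $F_4=-t_2p_4s_1+(t_1p_4+u_2)s_2-p_3s_3+t_{123}D+t_{135}I_1+t_{136}I_2+t_{245}I_3$, $F_5=-t_2p_1s_1+(t_1p_1-t_2p_2)s_2+(t_1p_2+u_1)s_3+t_{123}U_1+t_{124}(p_1p_3+t_1p_2p_4+p_2u_2)-t_{125}I_1-t_{126}(t_2p_2p_4+p_1u_2)-(t_{136}A_1+t_{245}A_2+t_{246}A_3)$, $F_6=-t_2p_3s_1+(t_1p_3-t_2p_4)s_2+(t_1p_4+u_2)s_3+t_{123}(p_1p_3+t_1p_2p_4+p_4u_1)+t_{124}U_3-t_{125}(t_2p_2p_4+p_3u_1)-t_{126}I_3+t_{135}A_1+t_{136}A_2+t_{245}A_3$, $F_7=s_1s_3-s_2^2+(t_{123}p_2+t_{124}p_4)s_1-(t_{125}p_2+t_{126}p_4)s_2+\alpha(p_1^2-2p_2u_1-t_1p_2^2)+\gamma(p_3^2-2p_4u_2-t_1p_4^2)+\beta(p_2u_2+p_4u_1-p_1p_3+t_1p_2p_4)+a_0p_2^2+2a_1p_2p_4+a_2p_4^2-b_0p_1p_2-b_1(p_1p_4+p_2p_3)-b_2p_3p_4$, $F_8=s_2s_3+t_1s_1s_2-t_2s_1^2+(t_{123}p_1+t_{124}p_3)s_1-(t_{125}p_1+t_{126}p_3)s_2+\alpha(-2p_1u_1-2t_1p_1p_2+t_2p_2^2)+\gamma(-2p_3u_2-2t_1p_3p_4+t_2p_4^2)+\beta\big(p_1u_2+p_3u_1+t_1(p_1p_4+p_2p_3)-t_2p_2p_4\big)-b_0p_1^2-2b_1p_1p_3-b_2p_3^2+a_0p_1p_2+a_1(p_1p_4+p_2p_3)+a_2p_3p_4$,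 $F_9=s_3^2+t_1s_2^2-t_2s_1s_2+(t_{123}u_1+t_{124}u_2)s_1-(t_{125}u_1+t_{126}u_2)s_2-\alpha(2t_2p_1p_2+u_1^2)+\beta\big(t_2(p_2p_3+p_1p_4)+u_1u_2\big)-\gamma(2t_2p_3p_4+u_2^2)-t_1(a_0p_2^2+2a_1p_2p_4+a_2p_4^2)+t_2(b_0p_2^2+2b_1p_2p_4+b_2p_4^2)-a_0p_1^2-2a_1p_1p_3-a_2p_3^2+(t_{124}t_{125}-t_{123}t_{126})D$. *)

theory Defs
  imports
    "HOL-Analysis.Analysis"
    "HOL-Library.Poly_Mapping"
    "HOL-Algebra.Group"
begin

section \<open>The affine space and the closed subscheme\<close>

datatype coord =
    P1 | P2 | P3 | P4 | U1 | U2 | S1 | S2 | S3 | T1 | T2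
  | T123 | T124 | T125 | T126 | T135 | T136 | T245 | T246

text \<open>
  An \<open>R\<close>-valued point of the affine 19-space is a function \<open>coord \<Rightarrow> R\<close>.  The equations below are
  polynomial expressions with integer coefficients, so they can be evaluated at a point with values
  in any commutative ring.  Evaluated at the tautological point with values in the polynomial ring
  (\<open>generic_point\<close> below), they are the polynomials themselves.
\<close>

context
  fixes x :: "coord \<Rightarrow> 'r::comm_ring_1"
begin

private abbreviation (input) "p1 \<equiv> x P1"
private abbreviation (input) "p2 \<equiv> x P2"
private abbreviation (input) "p3 \<equiv> x P3"
private abbreviation (input) "p4 \<equiv> x P4"
private abbreviation (input) "u1 \<equiv> x U1"
private abbreviation (input) "u2 \<equiv> x U2"
private abbreviation (input) "s1 \<equiv> x S1"
private abbreviation (input) "s2 \<equiv> x S2"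
private abbreviation (input) "s3 \<equiv> x S3"
private abbreviation (input) "t1 \<equiv> x T1"
private abbreviation (input) "t2 \<equiv> x T2"
private abbreviation (input) "t123 \<equiv> x T123"
private abbreviation (input) "t124 \<equiv> x T124"
private abbreviation (input) "t125 \<equiv> x T125"
private abbreviation (input) "t126 \<equiv> x T126"
private abbreviation (input) "t135 \<equiv> x T135"
private abbreviation (input) "t136 \<equiv> x T136"
private abbreviation (input) "t245 \<equiv> x T245"
private abbreviation (input) "t246 \<equiv> x T246"

definition "qD = p1 * p4 - p2 * p3"

definition "qU1 = p1^2 + t1 * p2^2 + p2 * u1"
definition "qU2 = 2 * p1 * p3 + 2 * t1 * p2 * p4 + p4 * u1 + p2 * u2"
definition "qU3 = p3^2 + t1 * p4^2 + p4 * u2"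

definition "qI1 = t2 * p2^2 + p1 * u1"
definition "qI2 = 2 * t2 * p2 * p4 + p3 * u1 + p1 * u2"
definition "qI3 = t2 * p4^2 + p3 * u2"

definition "qA1 = t1 * p2 * u1 - t2 * p1 * p2 + u1^2"
definition "qA2 = t1 * (p4 * u1 + p2 * u2) - t2 * (p2 * p3 + p1 * p4) + 2 * u1 * u2"
definition "qA3 = t1 * p4 * u2 - t2 * p3 * p4 + u2^2"

definition "q\<alpha> = t136^2 - t135 * t245"
definition "q\<beta> = t135 * t246 - t136 * t245"
definition "q\<gamma> = t245^2 - t136 * t246"

definition "qa0 = t123 * t136 - t124 * t135"
definition "qa1 = t123 * t245 - t124 * t136"
definition "qa2 = t123 * t246 - t124 * t245"

definition "qb0 = t125 * t136 - t126 * t135"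
definition "qb1 = t125 * t245 - t126 * t136"
definition "qb2 = t125 * t246 - t126 * t245"

definition "F1 = u1 * s1 - p1 * s2 - p2 * s3 - t126 * qD - (t136 * qU1 + t245 * qU2 + t246 * qU3)"

definition "F2 = u2 * s1 - p3 * s2 - p4 * s3 + t125 * qD + t135 * qU1 + t136 * qU2 + t245 * qU3"

definition "F3 = - t2 * p2 * s1 + (t1 * p2 + u1) * s2 - p1 * s3 - t124 * qD
  - (t136 * qI1 + t245 * qI2 + t246 * qI3)"

definition "F4 = - t2 * p4 * s1 + (t1 * p4 + u2) * s2 - p3 * s3 + t123 * qD
  + t135 * qI1 + t136 * qI2 + t245 * qI3"

definition "F5 = - t2 * p1 * s1 + (t1 * p1 - t2 * p2) * s2 + (t1 * p2 + u1) * s3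
  + t123 * qU1 + t124 * (p1 * p3 + t1 * p2 * p4 + p2 * u2)
  - t125 * qI1 - t126 * (t2 * p2 * p4 + p1 * u2)
  - (t136 * qA1 + t245 * qA2 + t246 * qA3)"

definition "F6 = - t2 * p3 * s1 + (t1 * p3 - t2 * p4) * s2 + (t1 * p4 + u2) * s3
  + t123 * (p1 * p3 + t1 * p2 * p4 + p4 * u1) + t124 * qU3
  - t125 * (t2 * p2 * p4 + p3 * u1) - t126 * qI3
  + t135 * qA1 + t136 * qA2 + t245 * qA3"

definition "F7 = s1 * s3 - s2^2 + (t123 * p2 + t124 * p4) * s1 - (t125 * p2 + t126 * p4) * s2
  + q\<alpha> * (p1^2 - 2 * p2 * u1 - t1 * p2^2)
  + q\<gamma> * (p3^2 - 2 * p4 * u2 - t1 * p4^2)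
  + q\<beta> * (p2 * u2 + p4 * u1 - p1 * p3 + t1 * p2 * p4)
  + qa0 * p2^2 + 2 * qa1 * p2 * p4 + qa2 * p4^2
  - qb0 * p1 * p2 - qb1 * (p1 * p4 + p2 * p3) - qb2 * p3 * p4"

definition "F8 = s2 * s3 + t1 * s1 * s2 - t2 * s1^2 + (t123 * p1 + t124 * p3) * s1 - (t125 * p1 + t126 * p3) * s2
  + q\<alpha> * (- 2 * p1 * u1 - 2 * t1 * p1 * p2 + t2 * p2^2)
  + q\<gamma> * (- 2 * p3 * u2 - 2 * t1 * p3 * p4 + t2 * p4^2)
  + q\<beta> * (p1 * u2 + p3 * u1 + t1 * (p1 * p4 + p2 * p3) - t2 * p2 * p4)
  - qb0 * p1^2 - 2 * qb1 * p1 * p3 - qb2 * p3^2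
  + qa0 * p1 * p2 + qa1 * (p1 * p4 + p2 * p3) + qa2 * p3 * p4"

definition "F9 = s3^2 + t1 * s2^2 - t2 * s1 * s2 + (t123 * u1 + t124 * u2) * s1 - (t125 * u1 + t126 * u2) * s2
  - q\<alpha> * (2 * t2 * p1 * p2 + u1^2)
  + q\<beta> * (t2 * (p2 * p3 + p1 * p4) + u1 * u2)
  - q\<gamma> * (2 * t2 * p3 * p4 + u2^2)
  - t1 * (qa0 * p2^2 + 2 * qa1 * p2 * p4 + qa2 * p4^2)
  + t2 * (qb0 * p2^2 + 2 * qb1 * p2 * p4 + qb2 * p4^2)
  - qa0 * p1^2 - 2 * qa1 * p1 * p3 - qa2 * p3^2
  + (t124 * t125 - t123 * t126) * qD"

definition "Pi15_equations = {F1, F2, F3, F4, F5, F6, F7, F8, F9}"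

end

text \<open>The set of \<open>R\<close>-valued points of the closed subscheme \<open>F\<^sub>1 = \<dots> = F\<^sub>9 = 0\<close>.\<close>

definition Pi15_points :: "(coord \<Rightarrow> 'r::comm_ring_1) set"
  where "Pi15_points = {x. \<forall>F\<in>Pi15_equations x. F = 0}"

text \<open>The polynomial ring over \<open>R\<close> in the 19 coordinates.\<close>

type_synonym 'r coord_poly = "(coord \<Rightarrow>\<^sub>0 nat) \<Rightarrow>\<^sub>0 'r"

definition poly_const :: "'r::comm_ring_1 \<Rightarrow> 'r coord_poly"
  where "poly_const r = Poly_Mapping.single 0 r"

definition generic_point :: "coord \<Rightarrow> 'r::comm_ring_1 coord_poly"
  where "generic_point v = Poly_Mapping.single (Poly_Mapping.single v 1) 1"

text \<open>The ideal generated by a set, as the submodule that it spans in the ring over itself.\<close>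

definition ideal_generated :: "'a::comm_ring_1 set \<Rightarrow> 'a set"
  where "ideal_generated B = module.span (*) B"


section \<open>Algebras, \<open>GL\<^sub>2\<close> and right actions\<close>

definition is_ring_hom :: "('r::comm_ring_1 \<Rightarrow> 's::comm_ring_1) \<Rightarrow> bool"
  where "is_ring_hom f \<longleftrightarrow>
    f 1 = 1 \<and> (\<forall>a b. f (a + b) = f a + f b) \<and> (\<forall>a b. f (a * b) = f a * f b)"

text \<open>A complex algebra is given by its structure map.\<close>

definition is_complex_algebra :: "(complex \<Rightarrow> 'r::comm_ring_1) \<Rightarrow> bool"
  where "is_complex_algebra \<iota> \<longleftrightarrow> is_ring_hom \<iota>"

definition is_complex_algebra_hom ::
    "(complex \<Rightarrow> 'r::comm_ring_1) \<Rightarrow> (complex \<Rightarrow> 's::comm_ring_1) \<Rightarrow> ('r \<Rightarrow> 's) \<Rightarrow> bool"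
  where "is_complex_algebra_hom \<iota> \<kappa> f \<longleftrightarrow> is_ring_hom f \<and> (\<forall>z. f (\<iota> z) = \<kappa> z)"

definition GL2 :: "('r::comm_ring_1 ^ 2 ^ 2) monoid"
  where "GL2 = \<lparr>carrier = {g. invertible g}, mult = (**), one = mat 1\<rparr>"

definition right_group_action :: "('g, 'm) monoid_scheme \<Rightarrow> 'e set \<Rightarrow> ('g \<Rightarrow> 'e \<Rightarrow> 'e) \<Rightarrow> bool"
  where "right_group_action G E act \<longleftrightarrow>
    group G \<and>
    (\<forall>g\<in>carrier G. \<forall>x\<in>E. act g x \<in> E) \<and>
    (\<forall>x\<in>E. act \<one>\<^bsub>G\<^esub> x = x) \<and>
    (\<forall>g\<in>carrier G. \<forall>h\<in>carrier G. \<forall>x\<in>E. act (g \<otimes>\<^bsub>G\<^esub> h) x = act h (act g x))"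


section \<open>The rule\<close>

text \<open>The inverse of a unit; it is only used for the determinant of an invertible matrix.\<close>

definition unit_inverse :: "'r::comm_ring_1 \<Rightarrow> 'r"
  where "unit_inverse r = (THE s. r * s = 1)"

definition gl2_hat :: "'r::comm_ring_1 ^ 2 ^ 2 \<Rightarrow> 'r ^ 3 ^ 3"
  where "gl2_hat g =
    (let a = g $ 1 $ 1; b = g $ 1 $ 2; c = g $ 2 $ 1; d = g $ 2 $ 2 in
     map_matrix (\<lambda>r. unit_inverse (det g) * r)
       (vector [vector [d^2, - c * d, c^2],
                vector [- 2 * b * d, b * c + a * d, - 2 * a * c],
                vector [b^2, - a * b, a^2]]))"

definition gl2_adjoint :: "'r::comm_ring_1 ^ 2 ^ 2 \<Rightarrow> 'r ^ 2 ^ 2"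
  where "gl2_adjoint g =
    vector [vector [g $ 2 $ 2, - (g $ 1 $ 2)],
            vector [- (g $ 2 $ 1), g $ 1 $ 1]]"

definition pu_matrix :: "(coord \<Rightarrow> 'r::comm_ring_1) \<Rightarrow> 'r ^ 2 ^ 3"
  where "pu_matrix x = vector [vector [x P1, x P3], vector [x P2, x P4], vector [x U1, x U2]]"

definition s_vector :: "(coord \<Rightarrow> 'r::comm_ring_1) \<Rightarrow> 'r ^ 3"
  where "s_vector x = vector [x S1, x S2, x S3]"

definition t12_matrix :: "(coord \<Rightarrow> 'r::comm_ring_1) \<Rightarrow> 'r ^ 2 ^ 2"
  where "t12_matrix x = vector [vector [x T123, x T125], vector [x T124, x T126]]"

definition t_matrix :: "(coord \<Rightarrow> 'r::comm_ring_1) \<Rightarrow> 'r ^ 3 ^ 2"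
  where "t_matrix x =
    vector [vector [x T136, x T245, x T246],
            vector [- x T135, - x T136, - x T245]]"

text \<open>
  \<open>y\<close> is an image of \<open>x\<close> under \<open>g\<close>.  The coordinates \<open>T136\<close> and \<open>T245\<close> occur twice in \<open>t_matrix\<close>,
  so that such a \<open>y\<close> exists is part of the assertion that the rule is well defined.
\<close>

definition gl2_rule ::
    "'r::comm_ring_1 ^ 2 ^ 2 \<Rightarrow> (coord \<Rightarrow> 'r) \<Rightarrow> (coord \<Rightarrow> 'r) \<Rightarrow> bool"
  where "gl2_rule g x y \<longleftrightarrow>
    pu_matrix y = pu_matrix x ** g \<and>
    s_vector y = det g *s s_vector x \<and>
    t12_matrix y = gl2_adjoint g ** t12_matrix x \<and>
    t_matrix y = transpose g ** t_matrix x ** gl2_hat g \<and>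
    y T1 = x T1 \<and>
    y T2 = x T2"

definition gl2_act :: "'r::comm_ring_1 ^ 2 ^ 2 \<Rightarrow> (coord \<Rightarrow> 'r) \<Rightarrow> (coord \<Rightarrow> 'r)"
  where "gl2_act g x = (THE y. gl2_rule g x y)"

end

theory Submission
  imports Defs
begin

text \<open>
  The blocks of coordinates are linear representations of \<open>GL\<^sub>2\<close>, and the nine equations are
  assembled from covariants of these representations.

  Read the three rows \<open>p = (p\<^sub>1, p\<^sub>3)\<close>, \<open>q = (p\<^sub>2, p\<^sub>4)\<close>, \<open>u = (u\<^sub>1, u\<^sub>2)\<close> as vectors in the
  standard representation \<open>v \<mapsto> v g\<close>. The coordinates \<open>t\<^sub>1\<^sub>3\<^sub>5, t\<^sub>1\<^sub>3\<^sub>6, t\<^sub>2\<^sub>4\<^sub>5, t\<^sub>2\<^sub>4\<^sub>6\<close> are the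
  coefficients of a binary cubic, and \<open>t_matrix\<close> is the symmetric bilinear map \<open>K\<close> (\<open>cubic_polar\<close>)
  on row vectors that arises by polarising it. The matrix \<open>gl2_hat g\<close> is \<open>det g\<close> times the inverse
  of the symmetric square of \<open>g\<close>, and for this reason \<open>K\<close> at the image point satisfies \<open>K (v g) (w
  g) = det g \<cdot> K v w \<cdot> g\<close>. The endomorphism \<open>K v\<close> has trace zero, so by the Cayley-Hamilton
  theorem its square is a scalar. This scalar is the quadratic form with coefficients \<open>\<alpha>, -\<beta>, \<gamma>\<close>,
  the Hessian of the cubic up to a constant factor; it is therefore multiplied by \<open>(det g)\<^sup>2\<close>. The
  columns of \<open>t12_matrix\<close> are linear forms on row vectors and are multiplied by \<open>det g\<close>, because
  \<open>g\<close> times its adjoint is \<open>det g\<close>. The expressions \<open>a\<^sub>0, a\<^sub>1, a\<^sub>2\<close> and \<open>b\<^sub>0, b\<^sub>1, b\<^sub>2\<close> are the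
  coefficients of the compositions of these forms with \<open>K\<close>.

  In these terms the pairs \<open>(F\<^sub>1, F\<^sub>2)\<close>, \<open>(F\<^sub>3, F\<^sub>4)\<close>, \<open>(F\<^sub>5, F\<^sub>6)\<close> are row vectors in the
  standard representation twisted by the determinant, and \<open>F\<^sub>7, F\<^sub>8, F\<^sub>9\<close> are semi-invariants of
  weight \<open>(det g)\<^sup>2\<close> (\<open>F12_image\<close>, \<open>F34_image\<close>, \<open>F56_image\<close>, \<open>F789_image\<close>). Hence the equations at
  the image point lie in the ideal of the equations at the point, and applying this to the inverse
  matrix gives equality of the ideals (\<open>ideal_image_eq\<close>), over every commutative ring. Over the
  polynomial ring this is the statement on the defining ideal; at a point with values in the ring
  it says that vanishing of the equations is preserved.

  The composition law comes from the multiplicativity of \<open>gl2_hat g\<close> and the antimultiplicativity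
  of the adjoint. Functoriality holds since both rule and equations are polynomial, apart from the
  inverse of the determinant, which ring homomorphisms respect.
\<close>


section \<open>The rule determines a unique image point\<close>

lemmas matrix_entries = vec_eq_iff forall_2 forall_3 matrix_matrix_mult_def sum_2 sum_3

lemma point_eqI:
  assumes "pu_matrix y = pu_matrix z" "s_vector y = s_vector z"
    and "t12_matrix y = t12_matrix z" "t_matrix y = t_matrix z"
    and "y T1 = z T1" "y T2 = z T2"
  shows "y = z"
proof
  fix v show "y v = z v"
    using assms
    by (cases v)
      (simp_all add: pu_matrix_def s_vector_def t12_matrix_def t_matrix_def matrix_entries)
qed

text \<open>
  The candidate for the image, with the coordinates read off from the prescribed matrices. The
  rule prescribes \<open>T136\<close> and \<open>T245\<close> twice; here they are taken from the first row.
\<close>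

definition gl2_image :: "'r::comm_ring_1 ^ 2 ^ 2 \<Rightarrow> (coord \<Rightarrow> 'r) \<Rightarrow> coord \<Rightarrow> 'r" where
  "gl2_image g x v =
    (let N = pu_matrix x ** g; T = gl2_adjoint g ** t12_matrix x;
         M = transpose g ** t_matrix x ** gl2_hat g
     in case v of
       P1 \<Rightarrow> N $ 1 $ 1 | P3 \<Rightarrow> N $ 1 $ 2
     | P2 \<Rightarrow> N $ 2 $ 1 | P4 \<Rightarrow> N $ 2 $ 2
     | U1 \<Rightarrow> N $ 3 $ 1 | U2 \<Rightarrow> N $ 3 $ 2
     | S1 \<Rightarrow> det g * x S1 | S2 \<Rightarrow> det g * x S2 | S3 \<Rightarrow> det g * x S3
     | T1 \<Rightarrow> x T1 | T2 \<Rightarrow> x T2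
     | T123 \<Rightarrow> T $ 1 $ 1 | T125 \<Rightarrow> T $ 1 $ 2 | T124 \<Rightarrow> T $ 2 $ 1 | T126 \<Rightarrow> T $ 2 $ 2
     | T136 \<Rightarrow> M $ 1 $ 1 | T245 \<Rightarrow> M $ 1 $ 2 | T246 \<Rightarrow> M $ 1 $ 3 | T135 \<Rightarrow> - M $ 2 $ 1)"

text \<open>
  This is the consistency of the two prescriptions for \<open>T136\<close> and \<open>T245\<close>: the matrices of the form
  \<open>t_matrix\<close> are those that come from a fully symmetric trilinear form, and symmetry is invariant
  under a change of basis.
\<close>

lemma t_matrix_shape_preserved:
  fixes g :: "'r::comm_ring_1 ^ 2 ^ 2"
  defines "M x \<equiv> transpose g ** t_matrix x ** gl2_hat g"
  shows "M x $ 2 $ 2 = - M x $ 1 $ 1" "M x $ 2 $ 3 = - M x $ 1 $ 2"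
  by (simp_all add: M_def t_matrix_def gl2_hat_def transpose_def matrix_entries Let_def
      algebra_simps power2_eq_square)

lemma gl2_rule_image: "gl2_rule g x (gl2_image g x)"
  using t_matrix_shape_preserved[of g x]
  by (simp add: gl2_rule_def vec_eq_iff forall_2 forall_3 gl2_image_def Let_def
      pu_matrix_def[of "gl2_image g x"] s_vector_def t12_matrix_def[of "gl2_image g x"]
      t_matrix_def[of "gl2_image g x"])

lemma gl2_rule_unique: "gl2_rule g x y \<Longrightarrow> gl2_rule g x z \<Longrightarrow> y = z"
  unfolding gl2_rule_def by (intro point_eqI) simp_all

lemma gl2_rule_ex1: "\<exists>!y. gl2_rule g x y"
  using gl2_rule_image gl2_rule_unique by blast

lemma gl2_act_rule: "gl2_rule g x (gl2_act g x)"
  unfolding gl2_act_def by (rule theI'[OF gl2_rule_ex1])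

lemma gl2_act_eqI: "gl2_rule g x y \<Longrightarrow> gl2_act g x = y"
  using gl2_act_rule gl2_rule_unique by blast


section \<open>The group and the composition law\<close>

lemma unit_inverse_eqI:
  fixes r :: "'r::comm_ring_1"
  assumes "r * s = 1"
  shows "unit_inverse r = s"
  unfolding unit_inverse_def
proof (rule the_equality[of "\<lambda>s. r * s = 1", OF assms])
  fix t assume "r * t = 1"
  then show "t = s" using assms by (metis mult.commute mult.left_commute mult_1_right)
qed

lemma det_unit_inverse:
  fixes g :: "'r::comm_ring_1 ^ 2 ^ 2"
  assumes "invertible g"
  shows "det g * unit_inverse (det g) = 1"
proof -
  obtain h where "g ** h = mat 1" using assms unfolding invertible_def by blast
  then have "det g * det h = 1" by (metis det_I det_mul)
  then show ?thesis using unit_inverse_eqI by metis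
qed

lemma group_GL2: "group (GL2 :: ('r::comm_ring_1 ^ 2 ^ 2) monoid)"
proof (rule groupI)
  fix g h :: "'r ^ 2 ^ 2"
  assume "g \<in> carrier GL2" "h \<in> carrier GL2"
  then obtain g' h' where "g ** g' = mat 1" "g' ** g = mat 1" "h ** h' = mat 1" "h' ** h = mat 1"
    unfolding GL2_def invertible_def by auto
  then have "(g ** h) ** (h' ** g') = mat 1 \<and> (h' ** g') ** (g ** h) = mat 1"
    by (metis matrix_mul_assoc matrix_mul_lid)
  then show "g \<otimes>\<^bsub>GL2\<^esub> h \<in> carrier GL2"
    unfolding GL2_def invertible_def by auto
next
  fix g :: "'r ^ 2 ^ 2"
  assume "g \<in> carrier GL2"
  then show "\<exists>h\<in>carrier GL2. h \<otimes>\<^bsub>GL2\<^esub> g = \<one>\<^bsub>GL2\<^esub>"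
    unfolding GL2_def invertible_def by auto
qed (auto simp: GL2_def matrix_mul_assoc invertible_def intro: exI[of _ "mat 1"])

lemma gl2_hat_one: "gl2_hat (mat 1) = (mat 1 :: 'r::comm_ring_1 ^ 3 ^ 3)"
proof -
  have "unit_inverse (1::'r) = 1" by (rule unit_inverse_eqI) simp
  then show ?thesis by (simp add: gl2_hat_def Let_def matrix_entries mat_def det_2)
qed

lemma gl2_hat_mult:
  fixes g h :: "'r::comm_ring_1 ^ 2 ^ 2"
  assumes "invertible g" "invertible h"
  shows "gl2_hat (g ** h) = gl2_hat g ** gl2_hat h"
proof -
  have "det (g ** h) * (unit_inverse (det g) * unit_inverse (det h))
      = (det g * unit_inverse (det g)) * (det h * unit_inverse (det h))"
    by (simp add: det_mul ac_simps)
  then have "unit_inverse (det (g ** h)) = unit_inverse (det g) * unit_inverse (det h)"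
    by (intro unit_inverse_eqI) (simp add: det_unit_inverse assms)
  then show ?thesis
    by (simp add: gl2_hat_def Let_def) (simp add: matrix_entries algebra_simps power2_eq_square)
qed

lemma gl2_adjoint_mult: "gl2_adjoint (g ** h) = gl2_adjoint h ** gl2_adjoint g"
  by (simp add: gl2_adjoint_def matrix_entries algebra_simps)

lemma gl2_adjoint_right: "g ** gl2_adjoint g = mat (det g)"
  by (simp add: gl2_adjoint_def matrix_entries mat_def det_2 algebra_simps)

lemma gl2_rule_one: "gl2_rule (mat 1) x x"
proof -
  have "gl2_adjoint (mat 1) = (mat 1 :: 'a ^ 2 ^ 2)"
    by (simp add: gl2_adjoint_def matrix_entries mat_def)
  then show ?thesis
    by (simp add: gl2_rule_def gl2_hat_one)
qed

lemma gl2_rule_mult: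
  assumes "invertible g" "invertible h" and "gl2_rule g x y" "gl2_rule h y z"
  shows "gl2_rule (g ** h) x z"
  using assms(3,4)
  by (simp add: gl2_rule_def gl2_hat_mult[OF assms(1,2)] gl2_adjoint_mult matrix_transpose_mul
      matrix_mul_assoc det_mul vector_smult_assoc mult.commute)

lemma gl2_act_mult:
  assumes "invertible g" "invertible h"
  shows "gl2_act (g ** h) x = gl2_act h (gl2_act g x)"
  by (rule gl2_act_eqI[OF gl2_rule_mult[OF assms gl2_act_rule gl2_act_rule]])


section \<open>Covariants of the rule\<close>

definition sym_prod :: "'r::comm_ring_1 ^ 2 \<Rightarrow> 'r ^ 2 \<Rightarrow> 'r ^ 3"
  where "sym_prod v w = vector [v $ 1 * w $ 1, v $ 1 * w $ 2 + v $ 2 * w $ 1, v $ 2 * w $ 2]"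

text \<open>
  Pairing \<open>cubic_polar x v w\<close> with a third row vector by the determinant gives the symmetric
  trilinear form of the binary cubic \<open>t\<^sub>1\<^sub>3\<^sub>5 X\<^sup>3 + 3 t\<^sub>1\<^sub>3\<^sub>6 X\<^sup>2 Y + 3 t\<^sub>2\<^sub>4\<^sub>5 X Y\<^sup>2 + t\<^sub>2\<^sub>4\<^sub>6
  Y\<^sup>3\<close>.
\<close>

definition cubic_polar :: "(coord \<Rightarrow> 'r::comm_ring_1) \<Rightarrow> 'r ^ 2 \<Rightarrow> 'r ^ 2 \<Rightarrow> 'r ^ 2"
  where "cubic_polar x v w = t_matrix x *v sym_prod v w"

text \<open>
  Minus the determinant of the endomorphism \<open>cubic_polar x v\<close>; up to a constant factor, the
  Hessian covariant of the cubic.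
\<close>

definition hess :: "(coord \<Rightarrow> 'r::comm_ring_1) \<Rightarrow> 'r ^ 2 \<Rightarrow> 'r"
  where "hess x v = q\<alpha> x * (v $ 1)^2 - q\<beta> x * (v $ 1 * v $ 2) + q\<gamma> x * (v $ 2)^2"

definition hess_polar :: "(coord \<Rightarrow> 'r::comm_ring_1) \<Rightarrow> 'r ^ 2 \<Rightarrow> 'r ^ 2 \<Rightarrow> 'r"
  where "hess_polar x v w = hess x (v + w) - hess x v - hess x w"

definition t12_forms :: "(coord \<Rightarrow> 'r::comm_ring_1) \<Rightarrow> 'r ^ 2 \<Rightarrow> 'r ^ 2"
  where "t12_forms x v = v v* t12_matrix x"

text \<open>
  Column \<open>j\<close> of \<open>t12_matrix\<close> is a linear form on row vectors. The determinant pairing on row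
  vectors turns it into a row vector, which transforms by \<open>g\<close> itself.
\<close>

definition dual_t12 :: "(coord \<Rightarrow> 'r::comm_ring_1) \<Rightarrow> 2 \<Rightarrow> 'r ^ 2"
  where "dual_t12 x j = vector [- t12_matrix x $ 2 $ j, t12_matrix x $ 1 $ j]"

lemma row_times_nth:
  fixes g :: "'r::comm_ring_1 ^ 2 ^ 2"
  shows "(v v* g) $ j = v $ 1 * g $ 1 $ j + v $ 2 * g $ 2 $ j"
  by (simp add: vector_matrix_mult_def sum_2 mult.commute)

lemma smult_commute_matrix:
  fixes A :: "'r::comm_ring_1 ^ 'n ^ 'm"
  shows "A *v (k *s z) = k *s (A *v z)" "(k *s v) v* A = k *s (v v* A)"
  by (simp_all add: vec_eq_iff matrix_vector_mult_def vector_matrix_mult_def sum_distrib_left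
      ac_simps)

text \<open>
  Up to the factor \<open>det g\<close>, \<open>gl2_hat g\<close> inverts the symmetric square of \<open>g\<close>. One of the two
  factors \<open>det g\<close> that come out is cancelled by the denominator of \<open>gl2_hat g\<close>.
\<close>

lemma gl2_hat_sym_prod:
  fixes g :: "'r::comm_ring_1 ^ 2 ^ 2"
  assumes "invertible g"
  shows "gl2_hat g *v sym_prod (v v* g) (w v* g) = det g *s sym_prod v w"
proof -
  define e where "e = unit_inverse (det g)"
  let ?D = "g $ 1 $ 1 * g $ 2 $ 2 - g $ 1 $ 2 * g $ 2 $ 1"
  have "gl2_hat g *v sym_prod (v v* g) (w v* g) = (e * (?D * ?D)) *s sym_prod v w"
    by (simp add: vec_eq_iff forall_3 gl2_hat_def Let_def e_def[symmetric] sym_prod_def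
        matrix_vector_mult_def sum_3 row_times_nth algebra_simps power2_eq_square)
  moreover have "e * (?D * ?D) = det g"
    using det_unit_inverse[OF assms] unfolding e_def det_2 by (simp add: ac_simps)
  ultimately show ?thesis by simp
qed

locale gl2_image_point =
  fixes g :: "'r::comm_ring_1 ^ 2 ^ 2" and x y :: "coord \<Rightarrow> 'r"
  assumes inv: "invertible g" and rule: "gl2_rule g x y"
begin

lemma cubic_polar_image: "cubic_polar y (v v* g) (w v* g) = det g *s (cubic_polar x v w v* g)"
proof -
  have "cubic_polar y (v v* g) (w v* g)
      = transpose g *v (t_matrix x *v (gl2_hat g *v sym_prod (v v* g) (w v* g)))"
    using rule by (simp add: cubic_polar_def gl2_rule_def matrix_vector_mul_assoc matrix_mul_assoc)
  also have "\<dots> = transpose g *v (t_matrix x *v (det g *s sym_prod v w))"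
    by (simp only: gl2_hat_sym_prod[OF inv])
  also have "\<dots> = det g *s (cubic_polar x v w v* g)"
    by (simp add: cubic_polar_def smult_commute_matrix)
  finally show ?thesis .
qed

lemma t12_forms_image: "t12_forms y (v v* g) = det g *s t12_forms x v"
proof -
  have "t12_forms y (v v* g) = v v* (g ** gl2_adjoint g ** t12_matrix x)"
    using rule by (simp add: t12_forms_def gl2_rule_def vector_matrix_mul_assoc matrix_mul_assoc)
  also have "\<dots> = v v* (mat (det g) ** t12_matrix x)"
    by (simp only: gl2_adjoint_right)
  also have "\<dots> = det g *s t12_forms x v"
    by (simp add: t12_forms_def vec_eq_iff vector_matrix_mult_def matrix_matrix_mult_def
        forall_2 sum_2 mat_def algebra_simps)
  finally show ?thesis .
qed

lemma dual_t12_image: "dual_t12 y j = dual_t12 x j v* g"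
proof -
  have t12: "t12_matrix y = gl2_adjoint g ** t12_matrix x"
    using rule by (simp add: gl2_rule_def)
  show ?thesis
    by (simp add: t12 dual_t12_def gl2_adjoint_def vec_eq_iff forall_2 row_times_nth
        matrix_matrix_mult_def sum_2 algebra_simps)
qed

end

text \<open>
  Cayley-Hamilton for the endomorphism \<open>cubic_polar x v\<close>, whose trace is zero since \<open>T136\<close> and
  \<open>T245\<close> occur twice in \<open>t_matrix\<close> with opposite signs.
\<close>

lemma cubic_polar_twice: "cubic_polar x v (cubic_polar x v w) = hess x v *s w"
  by (simp add: cubic_polar_def t_matrix_def sym_prod_def hess_def q\<alpha>_def q\<beta>_def q\<gamma>_def
      vec_eq_iff forall_2 matrix_vector_mult_def sum_3 algebra_simps power2_eq_square)

context gl2_image_point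
begin

text \<open>
  The Hessian is the scalar by which the square of \<open>cubic_polar x v\<close> acts, so its weight is twice
  that of \<open>cubic_polar\<close>.
\<close>

lemma hess_image: "hess y (v v* g) = (det g)^2 * hess x v"
proof -
  have eq: "hess y (v v* g) *s (w v* g) = ((det g)^2 * hess x v) *s (w v* g)" for w
  proof -
    have sc: "cubic_polar y u (c *s w) = c *s cubic_polar y u w" for u c w
      by (simp add: cubic_polar_def sym_prod_def vec_eq_iff matrix_vector_mult_def sum_3 algebra_simps)
    have "hess y (v v* g) *s (w v* g) = (det g * det g) *s (cubic_polar x v (cubic_polar x v w) v* g)"
      by (simp add: cubic_polar_twice[symmetric] cubic_polar_image sc)
    also have "\<dots> = (det g * det g * hess x v) *s (w v* g)"
      by (simp add: cubic_polar_twice vec_eq_iff row_times_nth algebra_simps)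
    finally show ?thesis by (simp add: power2_eq_square)
  qed
  \<comment> \<open>Scalars can be compared on the vector \<open>w g = (1, 0)\<close>, which is attained because \<open>g\<close> is invertible.\<close>
  obtain h where "h ** g = mat 1" using inv unfolding invertible_def by blast
  then have "(axis 1 1 v* h) v* g = axis 1 1"
    by (simp add: vector_matrix_mul_assoc)
  then show ?thesis using eq[of "axis 1 1 v* h"] by (simp add: vec_eq_iff forall_2 axis_def)
qed

lemma hess_polar_image: "hess_polar y (v v* g) (w v* g) = (det g)^2 * hess_polar x v w"
  by (simp add: hess_polar_def hess_image algebra_simps flip: vector_matrix_left_distrib)

end


section \<open>The equations are built from covariants\<close>

definition row_p :: "(coord \<Rightarrow> 'r::comm_ring_1) \<Rightarrow> 'r ^ 2" where "row_p x = pu_matrix x $ 1"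
definition row_q :: "(coord \<Rightarrow> 'r::comm_ring_1) \<Rightarrow> 'r ^ 2" where "row_q x = pu_matrix x $ 2"
definition row_u :: "(coord \<Rightarrow> 'r::comm_ring_1) \<Rightarrow> 'r ^ 2" where "row_u x = pu_matrix x $ 3"

lemmas covariant_defs = row_p_def row_q_def row_u_def pu_matrix_def t12_forms_def dual_t12_def
  t12_matrix_def cubic_polar_def t_matrix_def sym_prod_def hess_polar_def hess_def
  vec_eq_iff forall_2 matrix_vector_mult_def vector_matrix_mult_def sum_2 sum_3

context
  fixes x :: "coord \<Rightarrow> 'r::comm_ring_1"
begin

private abbreviation (input) "p \<equiv> row_p x"
private abbreviation (input) "q \<equiv> row_q x"
private abbreviation (input) "u \<equiv> row_u x"

text \<open>
  Each of the following right-hand sides uses only the invariants \<open>t\<^sub>1, t\<^sub>2\<close>, the weight one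
  quantities \<open>s\<^sub>1, s\<^sub>2, s\<^sub>3\<close>, \<open>qD\<close> and \<open>det (t12_matrix x)\<close>, the rows \<open>p, q, u\<close>, and the
  covariants introduced above. The abbreviations \<open>U\<^sub>i\<close>, \<open>I\<^sub>i\<close>, \<open>A\<^sub>i\<close> are the coordinates of the
  symmetric tensors \<open>p p + t\<^sub>1 q q + q u\<close>, \<open>t\<^sub>2 q q + p u\<close> and \<open>t\<^sub>1 q u - t\<^sub>2 p q + u u\<close>, to which
  \<open>cubic_polar\<close> is applied.
\<close>

lemma F12_covariant:
  "vector [F1 x, F2 x] = x S1 *s u - x S2 *s p - x S3 *s q + qD x *s dual_t12 x 2
    - (cubic_polar x p p + x T1 *s cubic_polar x q q + cubic_polar x q u)"
  by (simp add: F1_def F2_def qU1_def qU2_def qU3_def covariant_defs algebra_simps power2_eq_square)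

lemma F34_covariant:
  "vector [F3 x, F4 x] = (x T1 * x S2 - x T2 * x S1) *s q + x S2 *s u - x S3 *s p
    + qD x *s dual_t12 x 1 - (x T2 *s cubic_polar x q q + cubic_polar x p u)"
  by (simp add: F3_def F4_def qI1_def qI2_def qI3_def covariant_defs algebra_simps power2_eq_square)

lemma F56_covariant:
  "vector [F5 x, F6 x] = (x T1 * x S2 - x T2 * x S1) *s p + (x T1 * x S3 - x T2 * x S2) *s q
    + x S3 *s u
    + (t12_forms x p $ 1 - t12_forms x u $ 2) *s p
    + (x T1 * t12_forms x q $ 1 + t12_forms x u $ 1 - x T2 * t12_forms x q $ 2) *s q
    - (x T1 *s cubic_polar x q u - x T2 *s cubic_polar x p q + cubic_polar x u u)"
  by (simp add: F5_def F6_def qU1_def qU2_def qU3_def qI1_def qI2_def qI3_def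
     qA1_def qA2_def qA3_def covariant_defs algebra_simps power2_eq_square)

text \<open>
  In \<open>F\<^sub>7, F\<^sub>8, F\<^sub>9\<close> the terms with \<open>a\<^sub>i\<close> and \<open>b\<^sub>i\<close> come from the first and the second linear form
  of \<open>t12_matrix\<close>, evaluated at \<open>cubic_polar\<close> of two rows; the terms with \<open>\<alpha>, \<beta>, \<gamma>\<close> come from
  values of the Hessian form and its polarisation.
\<close>

lemma F7_covariant:
  "F7 x = x S1 * x S3 - (x S2)^2 + t12_forms x q $ 1 * x S1 - t12_forms x q $ 2 * x S2
    + hess x p - hess_polar x q u - x T1 * hess x q
    + t12_forms x (cubic_polar x q q) $ 1 - t12_forms x (cubic_polar x p q) $ 2"
  by (simp add: F7_def qa0_def qa1_def qa2_def qb0_def qb1_def qb2_def covariant_defs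
     algebra_simps power2_eq_square)

lemma F8_covariant:
  "F8 x = x S2 * x S3 + x T1 * x S1 * x S2 - x T2 * (x S1)^2
    + t12_forms x p $ 1 * x S1 - t12_forms x p $ 2 * x S2
    - hess_polar x p u - x T1 * hess_polar x p q + x T2 * hess x q
    + t12_forms x (cubic_polar x p q) $ 1 - t12_forms x (cubic_polar x p p) $ 2"
  by (simp add: F8_def qa0_def qa1_def qa2_def qb0_def qb1_def qb2_def covariant_defs
     algebra_simps power2_eq_square)

lemma F9_covariant:
  "F9 x = (x S3)^2 + x T1 * (x S2)^2 - x T2 * x S1 * x S2
    + t12_forms x u $ 1 * x S1 - t12_forms x u $ 2 * x S2
    - x T2 * hess_polar x p q - hess x u
    - x T1 * t12_forms x (cubic_polar x q q) $ 1 + x T2 * t12_forms x (cubic_polar x q q) $ 2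
    - t12_forms x (cubic_polar x p p) $ 1
    - det (t12_matrix x) * qD x"
  by (simp add: F9_def qa0_def qa1_def qa2_def qb0_def qb1_def qb2_def covariant_defs det_2
     algebra_simps power2_eq_square)

end


section \<open>Covariance of the equations\<close>

context gl2_image_point
begin

lemma coord_image:
  "row_p y = row_p x v* g" "row_q y = row_q x v* g" "row_u y = row_u x v* g"
  "y S1 = det g * x S1" "y S2 = det g * x S2" "y S3 = det g * x S3"
  "y T1 = x T1" "y T2 = x T2"
  using rule
  by (simp_all add: gl2_rule_def s_vector_def row_p_def row_q_def row_u_def vec_eq_iff
      forall_2 forall_3 matrix_matrix_mult_def row_times_nth sum_2)

lemma qD_rows: "qD z = row_p z $ 1 * row_q z $ 2 - row_q z $ 1 * row_p z $ 2"
  by (simp add: qD_def row_p_def row_q_def pu_matrix_def mult.commute)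

lemma qD_image: "qD y = det g * qD x"
  by (simp add: qD_rows coord_image row_times_nth det_2 algebra_simps)

lemma t12_forms_smult: "t12_forms z (k *s v) = k *s t12_forms z v"
  by (simp add: t12_forms_def smult_commute_matrix)

lemma det_t12_image: "det (t12_matrix y) = det g * det (t12_matrix x)"
proof -
  have "det (gl2_adjoint g) = det g"
    by (simp add: gl2_adjoint_def det_2 mult.commute)
  then show ?thesis using rule by (simp add: gl2_rule_def det_mul)
qed

lemmas covariant_image = coord_image qD_image cubic_polar_image t12_forms_image dual_t12_image hess_image
  hess_polar_image t12_forms_smult det_t12_image

lemma F12_image: "vector [F1 y, F2 y] = det g *s (vector [F1 x, F2 x] v* g)"
  unfolding F12_covariant covariant_image
  by (simp add: vec_eq_iff row_times_nth algebra_simps)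

lemma F34_image: "vector [F3 y, F4 y] = det g *s (vector [F3 x, F4 x] v* g)"
  unfolding F34_covariant covariant_image
  by (simp add: vec_eq_iff row_times_nth algebra_simps)

lemma F56_image: "vector [F5 y, F6 y] = det g *s (vector [F5 x, F6 x] v* g)"
  unfolding F56_covariant covariant_image
  by (simp add: vec_eq_iff row_times_nth algebra_simps)

lemma F789_image: "F7 y = (det g)^2 * F7 x" "F8 y = (det g)^2 * F8 x" "F9 y = (det g)^2 * F9 x"
  unfolding F7_covariant F8_covariant F9_covariant covariant_image
  by (simp_all add: algebra_simps power2_eq_square)

end


section \<open>The defining ideal\<close>

lemma module_mult: "module ((*) :: 'a::comm_ring_1 \<Rightarrow> 'a \<Rightarrow> 'a)"
  by unfold_locales (simp_all add: algebra_simps)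

text \<open>
  By the transformation formulas the equations at the image point are linear combinations of those
  at the point.
\<close>

lemma ideal_image_subset:
  fixes g :: "'r::comm_ring_1 ^ 2 ^ 2"
  assumes "invertible g" "gl2_rule g x y"
  shows "ideal_generated (Pi15_equations y) \<subseteq> ideal_generated (Pi15_equations x)"
proof -
  interpret gl2_image_point g x y using assms by unfold_locales
  interpret ideal: module "(*) :: 'r \<Rightarrow> 'r \<Rightarrow> 'r" by (rule module_mult)
  let ?I = "ideal.span (Pi15_equations x)"
  have base: "F \<in> ?I" if "F \<in> Pi15_equations x" for F
    using that by (rule ideal.span_base)
  have comb: "det g * (F * k + G * l) \<in> ?I"
    if "F \<in> Pi15_equations x" "G \<in> Pi15_equations x" for F G k l
  proof -
    have "det g * (k * F + l * G) \<in> ?I"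
      by (intro ideal.span_scale ideal.span_add base that)
    then show ?thesis by (simp add: mult.commute)
  qed
  have mem: "F1 x \<in> Pi15_equations x" "F2 x \<in> Pi15_equations x" "F3 x \<in> Pi15_equations x"
    "F4 x \<in> Pi15_equations x" "F5 x \<in> Pi15_equations x" "F6 x \<in> Pi15_equations x"
    "F7 x \<in> Pi15_equations x" "F8 x \<in> Pi15_equations x" "F9 x \<in> Pi15_equations x"
    by (simp_all add: Pi15_equations_def)
  have "F1 y \<in> ?I" "F2 y \<in> ?I"
    using F12_image
    by (auto simp: vec_eq_iff forall_2 row_times_nth intro!: comb mem)
  moreover have "F3 y \<in> ?I" "F4 y \<in> ?I"
    using F34_image
    by (auto simp: vec_eq_iff forall_2 row_times_nth intro!: comb mem)
  moreover have "F5 y \<in> ?I" "F6 y \<in> ?I"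
    using F56_image
    by (auto simp: vec_eq_iff forall_2 row_times_nth intro!: comb mem)
  moreover have "F7 y \<in> ?I" "F8 y \<in> ?I" "F9 y \<in> ?I"
    unfolding F789_image by (intro ideal.span_scale base mem)+
  ultimately have "Pi15_equations y \<subseteq> ?I"
    by (simp add: Pi15_equations_def)
  then show ?thesis
    unfolding ideal_generated_def by (simp add: ideal.span_minimal)
qed

lemma ideal_image_eq:
  fixes g :: "'r::comm_ring_1 ^ 2 ^ 2"
  assumes "invertible g"
  shows "ideal_generated (Pi15_equations (gl2_act g x)) = ideal_generated (Pi15_equations x)"
proof
  show "ideal_generated (Pi15_equations (gl2_act g x)) \<subseteq> ideal_generated (Pi15_equations x)"
    by (rule ideal_image_subset[OF assms gl2_act_rule])
next
  obtain h where h: "g ** h = mat 1" "invertible h"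
    using assms unfolding invertible_def by blast
  have "gl2_act h (gl2_act g x) = x"
    using gl2_act_mult[OF assms h(2), of x] gl2_act_eqI[OF gl2_rule_one, of x] by (metis h(1))
  then have "gl2_rule h (gl2_act g x) x"
    using gl2_act_rule[of h "gl2_act g x"] by simp
  then show "ideal_generated (Pi15_equations x) \<subseteq> ideal_generated (Pi15_equations (gl2_act g x))"
    by (rule ideal_image_subset[OF h(2)])
qed

text \<open>
  Through this reformulation the invariance of the ideal also yields the invariance of the set of
  points.
\<close>

lemma Pi15_points_iff_ideal: "x \<in> Pi15_points \<longleftrightarrow> ideal_generated (Pi15_equations x) \<subseteq> {0}"
proof -
  interpret ideal: module "(*) :: 'a \<Rightarrow> 'a \<Rightarrow> 'a" by (rule module_mult)
  have "ideal_generated B \<subseteq> {0} \<longleftrightarrow> B \<subseteq> {0}" for B :: "'a set"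
    unfolding ideal_generated_def
    using ideal.span_superset ideal.span_minimal[OF _ ideal.subspace_single_0] by blast
  then show ?thesis unfolding Pi15_points_def by blast
qed

lemma gl2_act_Pi15:
  assumes "invertible g" "x \<in> Pi15_points"
  shows "gl2_act g x \<in> Pi15_points"
  using assms by (simp add: Pi15_points_iff_ideal ideal_image_eq)

lemma right_action: "right_group_action (GL2 :: ('r::comm_ring_1 ^ 2 ^ 2) monoid) Pi15_points gl2_act"
  unfolding right_group_action_def
  by (simp add: group_GL2) (simp add: GL2_def gl2_act_Pi15 gl2_act_mult gl2_act_eqI gl2_rule_one)


section \<open>Change of rings\<close>

locale comm_ring_hom =
  fixes f :: "'r::comm_ring_1 \<Rightarrow> 's::comm_ring_1"
  assumes hom: "is_ring_hom f"
begin

lemma hom_simps: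
  "f 1 = 1" "f (a + b) = f a + f b" "f (a * b) = f a * f b"
  "f 0 = 0" "f (- a) = - f a" "f (a - b) = f a - f b" "f (a ^ n) = f a ^ n" "f 2 = 2"
proof -
  have one: "f 1 = 1" and add: "\<And>a b. f (a + b) = f a + f b"
    and mult: "\<And>a b. f (a * b) = f a * f b"
    using hom unfolding is_ring_hom_def by auto
  show zero: "f 0 = 0" using add[of 0 0] by simp
  have minus: "f (- a) = - f a" for a
    using add[of a "- a"] zero by (simp add: eq_neg_iff_add_eq_0 add.commute)
  then show "f (- a) = - f a" .
  show "f (a - b) = f a - f b" using add[of a "- b"] minus by simp
  show "f (a ^ n) = f a ^ n" by (induction n) (simp_all add: one mult)
  show "f 2 = 2" using add[of 1 1] one by simp
qed (use hom in \<open>auto simp: is_ring_hom_def\<close>)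

lemma Pi15_equations_hom: "Pi15_equations (f \<circ> x) = f ` Pi15_equations x"
  by (simp add: Pi15_equations_def F1_def F2_def F3_def F4_def F5_def F6_def F7_def F8_def F9_def
      qD_def qU1_def qU2_def qU3_def qI1_def qI2_def qI3_def qA1_def qA2_def qA3_def
      q\<alpha>_def q\<beta>_def q\<gamma>_def qa0_def qa1_def qa2_def qb0_def qb1_def qb2_def hom_simps)

lemma Pi15_points_hom: "x \<in> Pi15_points \<Longrightarrow> f \<circ> x \<in> Pi15_points"
  by (auto simp: Pi15_points_def Pi15_equations_hom hom_simps)

lemma map_matrix_mult_hom:
  fixes A :: "'r ^ 'n ^ 'm"
  shows "map_matrix f (A ** B) = map_matrix f A ** map_matrix f B"
proof -
  have "f (sum h S) = (\<Sum>i\<in>S. f (h i))" for h :: "'n \<Rightarrow> 'r" and S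
    by (induction S rule: infinite_finite_induct) (simp_all add: hom_simps)
  then show ?thesis by (simp add: vec_eq_iff matrix_matrix_mult_def hom_simps)
qed

lemma map_matrix_mat_one: "map_matrix f (mat 1) = mat 1"
  by (simp add: vec_eq_iff mat_def hom_simps)

lemma invertible_map_matrix:
  assumes "invertible g"
  shows "invertible (map_matrix f g)"
proof -
  obtain h where "g ** h = mat 1" "h ** g = mat 1"
    using assms unfolding invertible_def by blast
  then show ?thesis
    unfolding invertible_def by (metis map_matrix_mult_hom map_matrix_mat_one)
qed

lemma det_map_matrix: "det (map_matrix f g) = f (det g)" for g :: "'r ^ 2 ^ 2"
  by (simp add: det_2 hom_simps)

lemma gl2_hat_hom:
  assumes "invertible g"
  shows "gl2_hat (map_matrix f g) = map_matrix f (gl2_hat g)"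
proof -
  have "f (det g) * f (unit_inverse (det g)) = 1"
    using det_unit_inverse[OF assms] by (metis hom_simps(1,3))
  then have "unit_inverse (det (map_matrix f g)) = f (unit_inverse (det g))"
    by (simp add: det_map_matrix unit_inverse_eqI)
  then show ?thesis
    by (simp add: gl2_hat_def Let_def vec_eq_iff forall_3 hom_simps)
qed

lemma gl2_rule_hom:
  assumes "invertible g" "gl2_rule g x y"
  shows "gl2_rule (map_matrix f g) (f \<circ> x) (f \<circ> y)"
proof -
  have blocks: "pu_matrix (f \<circ> z) = map_matrix f (pu_matrix z)"
    "s_vector (f \<circ> z) = (\<chi> i. f (s_vector z $ i))"
    "t12_matrix (f \<circ> z) = map_matrix f (t12_matrix z)"
    "t_matrix (f \<circ> z) = map_matrix f (t_matrix z)" for z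
    by (simp_all add: pu_matrix_def s_vector_def t12_matrix_def t_matrix_def vec_eq_iff
        forall_2 forall_3 hom_simps)
  have "gl2_adjoint (map_matrix f g) = map_matrix f (gl2_adjoint g)"
    by (simp add: gl2_adjoint_def vec_eq_iff forall_2 hom_simps)
  moreover have "transpose (map_matrix f g) = map_matrix f (transpose g)"
    by (simp add: vec_eq_iff transpose_def)
  ultimately show ?thesis
    using assms(2)
    by (simp add: gl2_rule_def blocks gl2_hat_hom[OF assms(1)] map_matrix_mult_hom det_map_matrix)
      (simp add: vec_eq_iff hom_simps)
qed

lemma gl2_act_hom:
  assumes "invertible g"
  shows "gl2_act (map_matrix f g) (f \<circ> x) = f \<circ> gl2_act g x"
  by (intro gl2_act_eqI gl2_rule_hom assms gl2_act_rule)

end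

lemma poly_const_hom: "is_ring_hom (poly_const :: 'r::comm_ring_1 \<Rightarrow> 'r coord_poly)"
  by (simp add: is_ring_hom_def poly_const_def single_add mult_single)

theorem proposition5p2:
  fixes \<iota> :: "complex \<Rightarrow> 'r::comm_ring_1"
    and \<kappa> :: "complex \<Rightarrow> 's::comm_ring_1"
    and f :: "'r \<Rightarrow> 's"
  assumes "is_complex_algebra \<iota>"
    and "is_complex_algebra \<kappa>"
    and "is_complex_algebra_hom \<iota> \<kappa> f"
  shows
    "\<comment> \<open>the rule is well defined on points with values in a complex algebra\<close>
     (\<forall>g\<in>carrier GL2. \<forall>x :: coord \<Rightarrow> 'r. \<exists>!y. gl2_rule g x y) \<and>
     \<comment> \<open>it preserves the subscheme and is a right action on its points\<close>
     right_group_action (GL2 :: ('r ^ 2 ^ 2) monoid) Pi15_points gl2_act \<and>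
     \<comment> \<open>functoriality in the algebra, so that this is an action of the group scheme on the scheme\<close>
     (\<forall>x\<in>Pi15_points. f \<circ> x \<in> Pi15_points) \<and>
     (\<forall>g\<in>carrier GL2. map_matrix f g \<in> carrier GL2) \<and>
     (\<forall>g\<in>carrier GL2. \<forall>x\<in>Pi15_points.
        gl2_act (map_matrix f g) (f \<circ> x) = f \<circ> gl2_act g x) \<and>
     \<comment> \<open>the pullback of the defining ideal is the defining ideal\<close>
     (\<forall>g\<in>carrier (GL2 :: ('r ^ 2 ^ 2) monoid).
        ideal_generated (Pi15_equations (gl2_act (map_matrix poly_const g) generic_point))
        = ideal_generated (Pi15_equations (generic_point :: coord \<Rightarrow> 'r coord_poly)))"
proof -
  interpret comm_ring_hom f
    using assms(3) by unfold_locales (simp add: is_complex_algebra_hom_def)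
  interpret const: comm_ring_hom "poly_const :: 'r \<Rightarrow> 'r coord_poly"
    by unfold_locales (rule poly_const_hom)
  show ?thesis
    using right_action
    by (simp add: gl2_rule_ex1 Pi15_points_hom GL2_def invertible_map_matrix gl2_act_hom
        const.invertible_map_matrix ideal_image_eq)
qed

end
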